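(* Let $G=(G,+)$ be an abelian group, and let $$H+P=H+\{n_1v_1+\ldots+n_rv_r: n_i\in\mathbf{Z}, |n_i|\le N_i\text{ for all }1\le i\le r\}$$ be a proper coset progression in $G$ of rank $r$. Let $A\subset H+P$ be such that $|A|\ge\delta|H||P|$ for some $0<\delta<1$. Then there exist a subgroup $H'$ of $H$ with cardinality $|H'|\gg_{\delta,r}|H|$ and positive integers $1\le m,l\ll_{\delta,r}1$ such that $H'+P_l\subset mA-mA$, where $$P_l:=\{l n_1v_1+\ldots+l n_rv_r: n_i\in\mathbf{Z}, |n_i|\le N_i/l^2\text{ for all }1\le i\le r\}.$$ In fact, we have the stronger statement that each element $h+v$ of the coset progression $H'+P_l$ has $\gg_{\delta,r}|H|^{2m}|P|^{2m}$ representations of the form $h+v=a_1+\ldots+a_m-b_1-\ldots-b_m$ with $a_1,\ldots,a_m,b_1,\ldots,b_m\in A$.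
   Context: A coset progression of rank $r$ in an abelian group $G$ is a set $H+P$ where $H$ is a finite subgroup of $G$ and $P=\{n_1v_1+\ldots+n_rv_r: n_i\in\mathbf{Z},|n_i|\le N_i\text{ for all }1\le i\le r\}$ for some $v_1,\ldots,v_r\in G$ and $N_1,\ldots,N_r\ge1$. It is proper if the sums $h+n_1v_1+\ldots+n_rv_r$ with $h\in H$, $n_i\in\mathbf{Z}$, $|n_i|\le N_i$ are all distinct. $mA-mA:=\{a_1+\ldots+a_m-b_1-\ldots-b_m: a_i,b_i\in A\}$. $X\ll_pY$ (equivalently $Y\gg_pX$) means $|X|\le C_pY$ with $C_p$ depending only on the parameters $p$.
   Formalization: The number of representations is bounded below by |H|^{2m-1}|P|^{2m-1} instead of the printed |H|^{2m}|P|^{2m}, which fails for G=Z, H=0, A=P=[-N,N], N large; constants are stated for groups on one underlying set type, and a countable one serves all groups. *)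

theory Defs
  imports Complex_Main "HOL-Library.FuncSet" "HOL-Algebra.Coset" "HOL-Algebra.FiniteProduct"
begin

text \<open>
  Abelian groups are \<open>comm_group\<close> records, hence written multiplicatively: the additive
  combination $n_1 v_1 + \ldots + n_r v_r$ appears as a product of integer powers, and $H + P$
  as the set product \<open>H <#> P\<close>. Generators are indexed by $0, \ldots, r - 1$.
\<close>

definition lin_comb :: "('a, 'b) monoid_scheme \<Rightarrow> nat \<Rightarrow> (nat \<Rightarrow> 'a) \<Rightarrow> (nat \<Rightarrow> int) \<Rightarrow> 'a" where
  "lin_comb G r v n = (\<Otimes>\<^bsub>G\<^esub>i\<in>{..<r}. v i [^]\<^bsub>G\<^esub> n i)"

text \<open>
  Coefficient vectors are extensional functions on the index set, so that each vector occurs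
  exactly once; this matters for properness, which is injectivity on the box.
\<close>

definition coeff_box :: "nat \<Rightarrow> (nat \<Rightarrow> real) \<Rightarrow> (nat \<Rightarrow> int) set" where
  "coeff_box r N = (\<Pi>\<^sub>E i\<in>{..<r}. {k. real_of_int \<bar>k\<bar> \<le> N i})"

definition progression :: "('a, 'b) monoid_scheme \<Rightarrow> nat \<Rightarrow> (nat \<Rightarrow> 'a) \<Rightarrow> (nat \<Rightarrow> real) \<Rightarrow> 'a set" where
  "progression G r v N = lin_comb G r v ` coeff_box r N"

definition proper_coset_progression ::
    "('a, 'b) monoid_scheme \<Rightarrow> 'a set \<Rightarrow> nat \<Rightarrow> (nat \<Rightarrow> 'a) \<Rightarrow> (nat \<Rightarrow> real) \<Rightarrow> bool" where
  "proper_coset_progression G H r v N \<longleftrightarrow>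
     subgroup H G \<and> finite H \<and> v ` {..<r} \<subseteq> carrier G \<and> (\<forall>i<r. 1 \<le> N i) \<and>
     inj_on (\<lambda>(h, n). h \<otimes>\<^bsub>G\<^esub> lin_comb G r v n) (H \<times> coeff_box r N)"

text \<open>The set $P_l$: coefficients $l n_i$ with $|n_i| \le N_i / l^2$.\<close>

definition shrunk_progression ::
    "('a, 'b) monoid_scheme \<Rightarrow> nat \<Rightarrow> (nat \<Rightarrow> 'a) \<Rightarrow> (nat \<Rightarrow> real) \<Rightarrow> nat \<Rightarrow> 'a set" where
  "shrunk_progression G r v N l =
     (\<lambda>n. lin_comb G r v (\<lambda>i. int l * n i)) ` coeff_box r (\<lambda>i. N i / (real l)\<^sup>2)"

text \<open>
  Representations $x = a_1 + \ldots + a_m - b_1 - \ldots - b_m$, as pairs of ordered $m$-tuples;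
  tuples are again extensional, so that the cardinality of this set is the number of
  representations.
\<close>

definition representations :: "('a, 'b) monoid_scheme \<Rightarrow> nat \<Rightarrow> 'a set \<Rightarrow> 'a \<Rightarrow>
    ((nat \<Rightarrow> 'a) \<times> (nat \<Rightarrow> 'a)) set" where
  "representations G m A x =
     {(a, b). a \<in> {..<m} \<rightarrow>\<^sub>E A \<and> b \<in> {..<m} \<rightarrow>\<^sub>E A \<and>
        x = (\<Otimes>\<^bsub>G\<^esub>j\<in>{..<m}. a j) \<otimes>\<^bsub>G\<^esub> inv\<^bsub>G\<^esub> (\<Otimes>\<^bsub>G\<^esub>j\<in>{..<m}. b j)}"

definition iter_diff :: "('a, 'b) monoid_scheme \<Rightarrow> nat \<Rightarrow> 'a set \<Rightarrow> 'a set" where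
  "iter_diff G m A =
     {(\<Otimes>\<^bsub>G\<^esub>j\<in>{..<m}. a j) \<otimes>\<^bsub>G\<^esub> inv\<^bsub>G\<^esub> (\<Otimes>\<^bsub>G\<^esub>j\<in>{..<m}. b j) | a b.
        a \<in> {..<m} \<rightarrow>\<^sub>E A \<and> b \<in> {..<m} \<rightarrow>\<^sub>E A}"

end

(*
  Let n = |H||P| and let S be the set of quotients s for which A meets s^{-1} A in at least
  \<epsilon> n points. The translates of A by K elements of H + P live in H + 2P, so for large K two of
  them overlap substantially: among any K elements of H + P some quotient lies in S.

  Join x and y by an edge when their quotient lies in S. Every second vertex of a geodesic forms
  an independent set, so inside any V \<subseteq> H + P a connected component has diameter less than 2K.
  With V = H this gives <S \<inter> H> \<subseteq> S^{2K}, a subgroup of index at most K. With V the multiples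
  of v_i, pigeonhole yields 0 < d < K with d v_i in S, so every multiple of d v_i of size at most
  N_i v_i lies in S^{2K}; d divides l = K!.

  Hence H' + P_l \<subseteq> S^m with m = 2K(r + 1), and Cauchy--Schwarz shows that all elements of S^m
  have many representations.
*)
theory Submission
  imports Defs "HOL-Algebra.Generated_Groups" "HOL-Analysis.Convex"
begin

section \<open>Combinatorial tools: short paths, overlapping sets, collisions\<close>

text \<open>A shortest path of length at least 2K has K vertices at the even positions 0, 2, ..., 2K
  - 2. An edge between two of them would replace a stretch of length at least 2 by a single step,
  contradicting minimality.\<close>

lemma relpow_short_if_no_large_independent_set:
  assumes uw: "(u, w) \<in> R\<^sup>*"
    and R: "R \<subseteq> V \<times> V"
    and adj: "\<And>x. (\<And>i. i < K \<Longrightarrow> x i \<in> V) \<Longrightarrow> \<exists>i j. i < j \<and> j < K \<and> (x i, x j) \<in> R"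
  shows "\<exists>k<2 * K. (u, w) \<in> R ^^ k"
proof -
  define L where "L = (LEAST k. (u, w) \<in> R ^^ k)"
  have L: "(u, w) \<in> R ^^ L"
    using uw unfolding L_def by (metis LeastI rtrancl_imp_relpow)
  have "L < 2 * K"
  proof (rule ccontr)
    assume "\<not> L < 2 * K"
    then have K: "2 * K \<le> L" by simp
    obtain f where f: "f 0 = u" "f L = w" "\<And>i. i < L \<Longrightarrow> (f i, f (Suc i)) \<in> R"
      using L by (auto simp: relpow_fun_conv)
    have seg: "(f i, f (i + n)) \<in> R ^^ n" if "i + n \<le> L" for i n
      unfolding relpow_fun_conv
      by (rule exI[of _ "\<lambda>t. f (i + t)"]) (use that f(3) in auto)
    \<comment> \<open>Since 2i < 2K \<le> L, the vertex is the source of an edge of the path, and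
      \<open>R\<close> has its sources in \<open>V\<close>.\<close>
    have "f (2 * i) \<in> V" if "i < K" for i
      using f(3)[of "2 * i"] R K that by auto
    then obtain i j where ij: "i < j" "j < K" "(f (2 * i), f (2 * j)) \<in> R"
      using adj[of "\<lambda>i. f (2 * i)"] by blast
    have "(u, f (2 * i)) \<in> R ^^ (2 * i)"
      using seg[of 0 "2 * i"] f(1) ij K by simp
    moreover have "(f (2 * j), w) \<in> R ^^ (L - 2 * j)"
      using seg[of "2 * j" "L - 2 * j"] f(2) ij K by simp
    ultimately have "(u, w) \<in> R ^^ (2 * i + Suc (L - 2 * j))"
      unfolding relpow_add using relpow_Suc_I2[OF ij(3)] by blast
    then have "L \<le> 2 * i + Suc (L - 2 * j)"
      unfolding L_def by (rule Least_le)
    then show False using ij K by linarith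
  qed
  then show ?thesis using L by blast
qed

text \<open>Adding the sets one at a time, the set with index i contributes at least a - i b new
  points. The sum of the losses i b is bounded crudely by K^2 b, which keeps the induction
  simple.\<close>

lemma card_UN_ge_if_small_overlaps:
  fixes X :: "nat \<Rightarrow> 'b set"
  assumes "\<And>i. i < K \<Longrightarrow> finite (X i)" "\<And>i. i < K \<Longrightarrow> a \<le> real (card (X i))"
    and "\<And>i j. i < j \<Longrightarrow> j < K \<Longrightarrow> real (card (X i \<inter> X j)) \<le> b" and "0 \<le> b"
  shows "real K * a - (real K)\<^sup>2 * b \<le> real (card (\<Union>i<K. X i))"
  using assms
proof (induction K)
  case (Suc K)
  let ?U = "\<Union>i<K. X i"
  have fin: "finite ?U" "finite (X K)" using Suc.prems by auto
  have "?U \<inter> X K = (\<Union>i<K. X i \<inter> X K)" by blast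
  then have "card (?U \<inter> X K) \<le> (\<Sum>i<K. card (X i \<inter> X K))"
    using card_UN_le[of "{..<K}" "\<lambda>i. X i \<inter> X K"] by simp
  then have "real (card (?U \<inter> X K)) \<le> (\<Sum>i<K. real (card (X i \<inter> X K)))"
    by (metis of_nat_mono of_nat_sum)
  also have "\<dots> \<le> (\<Sum>i<K. b)"
    by (rule sum_mono) (use Suc.prems in auto)
  finally have overlap: "real (card (?U \<inter> X K)) \<le> real K * b" by simp
  have "real K * a - (real K)\<^sup>2 * b \<le> real (card ?U)"
    by (rule Suc.IH) (use Suc.prems in auto)
  moreover have "a \<le> real (card (X K))" using Suc.prems by simp
  moreover have "real (card ?U) + real (card (X K)) = real (card (?U \<union> X K)) + real (card (?U \<inter> X K))"
    using card_Un_Int[OF fin] by (metis of_nat_add)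
  moreover have "0 \<le> real K * b" using \<open>0 \<le> b\<close> by simp
  moreover have "(\<Union>i<Suc K. X i) = ?U \<union> X K" by (auto simp: lessThan_Suc)
  ultimately show ?case
    using overlap \<open>0 \<le> b\<close> by (simp add: algebra_simps power2_eq_square)
qed simp

text \<open>Cauchy--Schwarz over the fibres of \<open>f\<close>: the fibre sizes sum to |W|, and
  their squares sum to the number of colliding pairs.\<close>

lemma card_squared_le_card_collisions:
  assumes "finite W" "finite B" "f ` W \<subseteq> B"
  shows "(real (card W))\<^sup>2 \<le> real (card B) * real (card {(w, w'). w \<in> W \<and> w' \<in> W \<and> f w = f w'})"
proof -
  define F where "F b = {w \<in> W. f w = b}" for b
  have fin: "finite (F b)" for b using assms by (simp add: F_def)
  have "W = (\<Union>b\<in>B. F b)" using assms by (auto simp: F_def)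
  then have "card W = (\<Sum>b\<in>B. card (F b))"
    using card_UN_disjoint[of B F] assms fin by (auto simp: F_def)
  then have "(real (card W))\<^sup>2 = (\<Sum>b\<in>B. real (card (F b)))\<^sup>2" by simp
  also have "\<dots> \<le> (\<Sum>b\<in>B. (real (card (F b)))\<^sup>2) * real (card B)"
    by (rule sum_squared_le_sum_of_squares)
  also have "(\<Sum>b\<in>B. (real (card (F b)))\<^sup>2) = real (\<Sum>b\<in>B. card (F b \<times> F b))"
    by (simp add: card_cartesian_product power2_eq_square)
  also have "(\<Sum>b\<in>B. card (F b \<times> F b)) = card (\<Union>b\<in>B. F b \<times> F b)"
    by (rule card_UN_disjoint[symmetric]) (use assms fin in \<open>auto simp: F_def\<close>)
  also have "(\<Union>b\<in>B. F b \<times> F b) = {(w, w'). w \<in> W \<and> w' \<in> W \<and> f w = f w'}"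
    using assms by (auto simp: F_def)
  finally show ?thesis by (simp add: mult.commute)
qed

section \<open>Sizes of coefficient boxes and their dilates\<close>

lemma box_side_eq:
  assumes "0 \<le> x"
  shows "{k :: int. \<bar>real_of_int k\<bar> \<le> x} = {- \<lfloor>x\<rfloor>..\<lfloor>x\<rfloor>}"
proof -
  have "\<bar>real_of_int k\<bar> \<le> x \<longleftrightarrow> k \<in> {- \<lfloor>x\<rfloor>..\<lfloor>x\<rfloor>}" for k :: int
    by (auto simp: le_floor_iff abs_le_iff minus_le_iff[of "\<lfloor>x\<rfloor>"])
  then show ?thesis by blast
qed

text \<open>A side contains 2 \<lfloor>x\<rfloor> + 1 integers, and \<lfloor>kx\<rfloor> \<le> k
  (\<lfloor>x\<rfloor> + 1). The factor 2k instead of k absorbs the rounding, because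
  \<lfloor>x\<rfloor> \<ge> 1.\<close>

lemma card_box_side_dilate_le:
  assumes "1 \<le> x" "1 \<le> k"
  shows "card {j :: int. real_of_int \<bar>j\<bar> \<le> real k * x} \<le> 2 * k * card {j :: int. real_of_int \<bar>j\<bar> \<le> x}"
proof -
  have "real_of_int \<lfloor>real k * x\<rfloor> \<le> real k * x" by simp
  also have "\<dots> \<le> real k * (real_of_int \<lfloor>x\<rfloor> + 1)"
    by (rule mult_left_mono) linarith+
  finally have "real_of_int \<lfloor>real k * x\<rfloor> \<le> real_of_int (int k * (\<lfloor>x\<rfloor> + 1))" by simp
  then have "\<lfloor>real k * x\<rfloor> \<le> int k * (\<lfloor>x\<rfloor> + 1)"
    by (simp only: of_int_le_iff)
  moreover have "1 \<le> \<lfloor>x\<rfloor>" using assms by simp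
  moreover from this have "1 \<le> int k * \<lfloor>x\<rfloor>"
    using mult_mono[of 1 "int k" 1 "\<lfloor>x\<rfloor>"] assms by simp
  ultimately have "2 * \<lfloor>real k * x\<rfloor> + 1 \<le> 2 * int k * (2 * \<lfloor>x\<rfloor> + 1)"
    by (simp add: algebra_simps)
  then have "nat (2 * \<lfloor>real k * x\<rfloor> + 1) \<le> nat (2 * int k * (2 * \<lfloor>x\<rfloor> + 1))"
    by (rule nat_mono)
  then show ?thesis
    using assms by (simp add: box_side_eq nat_mult_distrib)
qed

lemma finite_coeff_box: "(\<And>i. i < r \<Longrightarrow> 0 \<le> N i) \<Longrightarrow> finite (coeff_box r N)"
  unfolding coeff_box_def by (rule finite_PiE) (auto simp: box_side_eq)

lemma card_coeff_box_dilate_le: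
  assumes "\<And>i. i < r \<Longrightarrow> 1 \<le> N i" "1 \<le> k"
  shows "card (coeff_box r (\<lambda>i. real k * N i)) \<le> (2 * k) ^ r * card (coeff_box r N)"
proof -
  have "card (coeff_box r (\<lambda>i. real k * N i)) = (\<Prod>i<r. card {j :: int. real_of_int \<bar>j\<bar> \<le> real k * N i})"
    by (simp add: coeff_box_def card_PiE)
  also have "\<dots> \<le> (\<Prod>i<r. 2 * k * card {j :: int. real_of_int \<bar>j\<bar> \<le> N i})"
    using assms by (intro prod_mono conjI card_box_side_dilate_le) auto
  also have "\<dots> = (2 * k) ^ r * card (coeff_box r N)"
    by (simp add: coeff_box_def card_PiE prod.distrib)
  finally show ?thesis .
qed

section \<open>Iterated product sets\<close>

primrec set_power :: "('a, 'b) monoid_scheme \<Rightarrow> 'a set \<Rightarrow> nat \<Rightarrow> 'a set" where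
  "set_power G S 0 = {\<one>\<^bsub>G\<^esub>}"
| "set_power G S (Suc k) = S <#>\<^bsub>G\<^esub> set_power G S k"

text \<open>The cardinality is that of A \<inter> s^{-1} A, equivalently the number of ways to write
  s as a quotient of two elements of A. The threshold \<open>t\<close> is an absolute count, not a
  proportion.\<close>

definition popular_quotients :: "('a, 'b) monoid_scheme \<Rightarrow> 'a set \<Rightarrow> real \<Rightarrow> 'a set" where
  "popular_quotients G A t = {s \<in> carrier G. t \<le> real (card {w \<in> A. s \<otimes>\<^bsub>G\<^esub> w \<in> A})}"

context comm_group
begin

lemma set_power_closed: "S \<subseteq> carrier G \<Longrightarrow> set_power G S k \<subseteq> carrier G"
  by (induction k) (auto simp: set_mult_closed)

lemma set_power_mult:
  assumes "S \<subseteq> carrier G" "x \<in> set_power G S j" "y \<in> set_power G S k"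
  shows "x \<otimes> y \<in> set_power G S (j + k)"
  using assms(2)
proof (induction j arbitrary: x)
  case 0
  then show ?case using assms set_power_closed[of S k] by auto
next
  case (Suc j)
  then obtain s z where "s \<in> S" "z \<in> set_power G S j" "x = s \<otimes> z"
    by (auto simp: set_mult_def)
  moreover have "z \<in> carrier G" "s \<in> carrier G" "y \<in> carrier G"
    using calculation assms set_power_closed[of S] by auto
  ultimately show ?case
    using Suc.IH[of z] by (auto simp: set_mult_def m_assoc)
qed

lemma set_power_mono:
  assumes "S \<subseteq> carrier G" "\<one> \<in> S" "j \<le> k"
  shows "set_power G S j \<subseteq> set_power G S k"
proof (rule lift_Suc_mono_le[OF _ \<open>j \<le> k\<close>])
  fix i show "set_power G S i \<subseteq> set_power G S (Suc i)"
  proof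
    fix x assume "x \<in> set_power G S i"
    then show "x \<in> set_power G S (Suc i)"
      using set_power_closed[OF assms(1), of i] assms(2) by (force simp: set_mult_def)
  qed
qed

lemma set_power_finprod:
  assumes "S \<subseteq> carrier G" "\<And>i. i < r \<Longrightarrow> f i \<in> set_power G S k"
  shows "(\<Otimes>i\<in>{..<r}. f i) \<in> set_power G S (k * r)"
  using assms(2)
proof (induction r)
  case (Suc r)
  have "f \<in> {..<Suc r} \<rightarrow> carrier G"
    using Suc.prems set_power_closed[OF assms(1)] by blast
  then have "(\<Otimes>i\<in>{..<Suc r}. f i) = f r \<otimes> (\<Otimes>i\<in>{..<r}. f i)"
    by (simp add: lessThan_Suc Pi_iff)
  then show ?case
    using set_power_mult[OF assms(1), of "f r" k] Suc by simp
qed simp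

lemma set_power_eq_finprod:
  assumes "S \<subseteq> carrier G" "x \<in> set_power G S k"
  obtains s where "s \<in> {..<k} \<rightarrow> S" "x = (\<Otimes>j\<in>{..<k}. s j)"
proof -
  have "\<exists>s. s \<in> {..<k} \<rightarrow> S \<and> x = (\<Otimes>j\<in>{..<k}. s j)"
    using assms(2)
  proof (induction k arbitrary: x)
    case (Suc k)
    then obtain a z where az: "a \<in> S" "z \<in> set_power G S k" "x = a \<otimes> z"
      by (auto simp: set_mult_def)
    with Suc.IH obtain s where s: "s \<in> {..<k} \<rightarrow> S" "z = (\<Otimes>j\<in>{..<k}. s j)" by blast
    let ?s = "s(k := a)"
    have "(\<Otimes>j\<in>{..<Suc k}. ?s j) = ?s k \<otimes> (\<Otimes>j\<in>{..<k}. ?s j)"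
      using az s assms(1) by (subst lessThan_Suc, subst finprod_insert) auto
    also have "(\<Otimes>j\<in>{..<k}. ?s j) = (\<Otimes>j\<in>{..<k}. s j)"
      by (rule finprod_cong') (use s assms(1) in auto)
    finally have "x = (\<Otimes>j\<in>{..<Suc k}. ?s j)" using az s by simp
    moreover have "?s \<in> {..<Suc k} \<rightarrow> S" using az s by (auto simp: less_Suc_eq)
    ultimately show ?case by blast
  qed simp
  then show ?thesis using that by blast
qed

section \<open>From paths in the quotient graph to products of bounded length\<close>

text \<open>Telescoping: the quotient of the two ends of a walk is the product of the quotients
  along its edges.\<close>

lemma relpow_quotients_in_set_power:
  assumes "S \<subseteq> carrier G" "V \<subseteq> carrier G"
    and "R = {(x, y). x \<in> V \<and> y \<in> V \<and> y \<otimes> inv x \<in> S}"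
    and "(u, w) \<in> R ^^ k" "u \<in> V"
  shows "w \<in> V \<and> w \<otimes> inv u \<in> set_power G S k"
  using assms(4)
proof (induction k arbitrary: w)
  case 0
  then show ?case using assms by auto
next
  case (Suc k)
  then obtain y where y: "(u, y) \<in> R ^^ k" "(y, w) \<in> R" by auto
  then have IH: "y \<in> V" "y \<otimes> inv u \<in> set_power G S k" using Suc.IH by auto
  have w: "w \<in> V" "w \<otimes> inv y \<in> S" using y assms(3) by auto
  have "u \<in> carrier G" "y \<in> carrier G" "w \<in> carrier G" using IH w assms by auto
  then have "w \<otimes> inv u = (w \<otimes> inv y) \<otimes> (y \<otimes> inv u)"
    by (simp add: m_assoc inv_solve_left)
  then show ?case using w IH by (auto simp: set_mult_def)
qed

text \<open>A path of any length can be shortened to fewer than 2K edges, so \<open>w\<close> is a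
  product of fewer than 2K elements of \<open>S\<close>; since \<open>S\<close> contains the
  identity, the product can be padded to exactly 2K factors.\<close>

lemma set_power_if_path:
  assumes S: "S \<subseteq> carrier G" "\<one> \<in> S" and V: "V \<subseteq> carrier G" "\<one> \<in> V"
    and adj: "\<And>x. (\<And>i. i < K \<Longrightarrow> x i \<in> V) \<Longrightarrow> \<exists>i j. i < j \<and> j < K \<and> x j \<otimes> inv x i \<in> S"
    and path: "(\<one>, w) \<in> {(x, y). x \<in> V \<and> y \<in> V \<and> y \<otimes> inv x \<in> S}\<^sup>*"
  shows "w \<in> set_power G S (2 * K)"
proof -
  define R where "R = {(x, y). x \<in> V \<and> y \<in> V \<and> y \<otimes> inv x \<in> S}"
  have "\<exists>k<2 * K. (\<one>, w) \<in> R ^^ k"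
  proof (rule relpow_short_if_no_large_independent_set)
    show "R \<subseteq> V \<times> V" by (auto simp: R_def)
    fix x :: "nat \<Rightarrow> 'a" assume "\<And>i. i < K \<Longrightarrow> x i \<in> V"
    moreover from this obtain i j where "i < j" "j < K" "x j \<otimes> inv x i \<in> S"
      using adj by blast
    ultimately show "\<exists>i j. i < j \<and> j < K \<and> (x i, x j) \<in> R"
      unfolding R_def by (metis (mono_tags, lifting) case_prodI less_trans mem_Collect_eq)
  qed (use path in \<open>simp add: R_def\<close>)
  then obtain k where "k < 2 * K" "(\<one>, w) \<in> R ^^ k" by blast
  then have "w \<in> carrier G" "w \<otimes> inv \<one> \<in> set_power G S k"
    using relpow_quotients_in_set_power[OF S(1) V(1) R_def _ V(2)] V by auto
  then show ?thesis
    using set_power_mono[OF S, of k "2 * K"] \<open>k < 2 * K\<close> by auto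
qed

text \<open>Translation by an element of \<open>H\<close> leaves quotients unchanged, so it maps
  paths in \<open>H\<close> to paths in \<open>H\<close>. Concatenating a path from the identity to
  a with the translate by a of a path from the identity to b leads to ab. Hence every element
  generated by S \<inter> H is connected to the identity, and short paths then bound the number of
  factors.\<close>

lemma generate_Int_subset_set_power:
  assumes S: "S \<subseteq> carrier G" "\<one> \<in> S" "\<And>s. s \<in> S \<Longrightarrow> inv s \<in> S" and H: "subgroup H G"
    and adj: "\<And>x. (\<And>i. i < K \<Longrightarrow> x i \<in> H) \<Longrightarrow> \<exists>i j. i < j \<and> j < K \<and> x j \<otimes> inv x i \<in> S"
  shows "generate G (S \<inter> H) \<subseteq> set_power G S (2 * K)"
proof
  define R where "R = {(x, y). x \<in> H \<and> y \<in> H \<and> y \<otimes> inv x \<in> S}"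
  have H': "H \<subseteq> carrier G" "\<one> \<in> H" using H by (auto simp: subgroup.subset subgroup.one_closed)
  have translate: "(x \<otimes> h, y \<otimes> h) \<in> R\<^sup>*" if "(x, y) \<in> R\<^sup>*" "h \<in> H" for x y h
    using that(1)
  proof induction
    case (step y z)
    then have "y \<in> carrier G" "z \<in> carrier G" "h \<in> carrier G" "y \<in> H" "z \<in> H" "z \<otimes> inv y \<in> S"
      using H' that(2) by (auto simp: R_def)
    moreover from this have "(z \<otimes> h) \<otimes> inv (y \<otimes> h) = z \<otimes> inv y"
      by (simp add: inv_mult m_assoc m_lcomm[of h])
    ultimately have "(y \<otimes> h, z \<otimes> h) \<in> R"
      using that(2) H by (simp add: R_def subgroup.m_closed)
    then show ?case using step by simp
  qed simp
  fix w assume "w \<in> generate G (S \<inter> H)"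
  then have "w \<in> H \<and> (\<one>, w) \<in> R\<^sup>*"
  proof (induction rule: generate.induct)
    case (eng a b)
    then have "(a, a \<otimes> b) \<in> R\<^sup>*"
      using translate[of \<one> b a] H' by (simp add: m_comm subset_iff)
    then show ?case using eng H by (auto simp: subgroup.m_closed intro: rtrancl_trans)
  qed (use S H H' in \<open>auto simp: R_def subgroup.m_inv_closed intro!: r_into_rtrancl\<close>)
  then show "w \<in> set_power G S (2 * K)"
    using set_power_if_path[OF S(1,2) H' adj] by (simp add: R_def)
qed

text \<open>The walk through successive powers of v^d stays among the powers of \<open>v\<close>
  with exponent at most M in absolute value, and each of its edges has quotient v^d or v^{-d}. Its
  length |j| is not controlled by K, but its endpoints are then also joined by a path with fewer
  than 2K edges.\<close>

lemma int_pow_multiple_in_set_power: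
  fixes d j :: int
  assumes S: "S \<subseteq> carrier G" "\<one> \<in> S" "\<And>s. s \<in> S \<Longrightarrow> inv s \<in> S" and v: "v \<in> carrier G"
    and adj: "\<And>x. (\<And>i. i < K \<Longrightarrow> \<exists>a. \<bar>a\<bar> \<le> M \<and> x i = v [^] a) \<Longrightarrow>
      \<exists>i j. i < j \<and> j < K \<and> x j \<otimes> inv x i \<in> S"
    and d: "0 < d" "v [^] d \<in> S" and j: "\<bar>d * j\<bar> \<le> M"
  shows "v [^] (d * j) \<in> set_power G S (2 * K)"
proof -
  define V where "V = (\<lambda>a :: int. v [^] a) ` {- M..M}"
  define R where "R = {(x, y). x \<in> V \<and> y \<in> V \<and> y \<otimes> inv x \<in> S}"
  have V: "V \<subseteq> carrier G" "\<one> \<in> V"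
    using v j by (auto simp: V_def intro!: image_eqI[of _ _ "0 :: int"])
  \<comment> \<open>The step \<open>e\<close> is signed, so that e = d serves nonnegative
    \<open>j\<close> and e = -d serves negative \<open>j\<close>.\<close>
  have walk: "(\<one>, v [^] (e * int k)) \<in> R\<^sup>*"
    if "\<bar>e * int k\<bar> \<le> M" "v [^] e \<in> S" for e :: int and k
    using that(1)
  proof (induction k)
    case (Suc k)
    have "\<bar>e * int k\<bar> \<le> \<bar>e * int (Suc k)\<bar>"
      by (simp add: abs_mult mult_left_mono)
    then have k: "\<bar>e * int k\<bar> \<le> M" using Suc.prems by simp
    have "v [^] (e * int (Suc k)) = v [^] e \<otimes> v [^] (e * int k)"
      using v by (simp add: distrib_left flip: int_pow_mult)
    then have "v [^] (e * int (Suc k)) \<otimes> inv (v [^] (e * int k)) = v [^] e"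
      using v by (simp add: m_assoc)
    then have "(v [^] (e * int k), v [^] (e * int (Suc k))) \<in> R"
      using k Suc.prems that(2) unfolding R_def V_def by (auto simp: abs_le_iff)
    then show ?case using Suc.IH[OF k] by (rule rtrancl_into_rtrancl[rotated])
  qed simp
  have "(\<one>, v [^] (d * j)) \<in> R\<^sup>*"
  proof (cases "0 \<le> j")
    case True
    then show ?thesis using walk[of d "nat j"] d j by simp
  next
    case False
    moreover have "v [^] (- d) \<in> S" using d S v by (simp add: int_pow_neg)
    ultimately show ?thesis using walk[of "- d" "nat (- j)"] j by simp
  qed
  moreover have "\<exists>i j. i < j \<and> j < K \<and> x j \<otimes> inv x i \<in> S" if "\<And>i. i < K \<Longrightarrow> x i \<in> V" for x
    by (rule adj) (use that in \<open>fastforce simp: V_def abs_le_iff\<close>)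
  ultimately show ?thesis
    using set_power_if_path[OF S(1,2) V] by (simp add: R_def)
qed

text \<open>Representatives of K distinct cosets of \<open>J\<close> in \<open>H\<close> would
  include two whose quotient lies in \<open>J\<close>, so the index is at most K and Lagrange's
  theorem applies.\<close>

lemma card_le_if_no_large_transversal:
  assumes H: "subgroup H G" "finite H" and J: "subgroup J G" "J \<subseteq> H"
    and adj: "\<And>x. (\<And>i. i < K \<Longrightarrow> x i \<in> H) \<Longrightarrow> \<exists>i j. i < j \<and> j < K \<and> x j \<otimes> inv x i \<in> J"
  shows "card H \<le> K * card J"
proof -
  interpret HG: group "G\<lparr>carrier := H\<rparr>"
    using H by (rule_tac subgroup_imp_group)
  define C where "C = rcosets\<^bsub>G\<lparr>carrier := H\<rparr>\<^esub> J"
  have J': "subgroup J (G\<lparr>carrier := H\<rparr>)"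
    using subgroup_incl[OF J(1) H(1) J(2)] .
  have lag: "card C * card J = card H"
    using HG.lagrange[OF J'] by (simp add: C_def order_def)
  have C_eq: "C = (\<lambda>x. J #> x) ` H"
    by (auto simp: C_def RCOSETS_def r_coset_def)
  have "card C \<le> K"
  proof (rule ccontr)
    assume "\<not> card C \<le> K"
    moreover have "finite C" using H by (simp add: C_eq)
    ultimately obtain f where f: "inj_on f {..<K}" "f ` {..<K} \<subseteq> C"
      using card_le_inj[of "{..<K}" C] by auto
    then have "\<forall>i<K. \<exists>x\<in>H. f i = J #> x" by (auto simp: C_eq)
    then obtain x where x: "\<And>i. i < K \<Longrightarrow> x i \<in> H \<and> f i = J #> x i" by metis
    with adj obtain i j where ij: "i < j" "j < K" "x j \<otimes> inv x i \<in> J" by blast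
    have "i < K" using ij by simp
    have xc: "x i \<in> carrier G" "x j \<in> carrier G"
      using x \<open>i < K\<close> \<open>j < K\<close> subgroup.mem_carrier[OF H(1)] by auto
    have "x j \<in> J #> x i"
      by (rule subgroup.rcos_module_rev[OF J(1) is_group xc ij(3)])
    then have "J #> x i = J #> x j"
      by (rule repr_independence[OF _ xc(1) J(1)])
    then have "f i = f j" using x \<open>i < K\<close> \<open>j < K\<close> by simp
    then show False using inj_onD[OF f(1), of i j] \<open>i < K\<close> ij by simp
  qed
  then show ?thesis using lag by (metis mult_le_mono1)
qed

section \<open>Popular quotients and counting representations\<close>

text \<open>Multiplication by s maps A \<inter> s^{-1} A bijectively onto A \<inter> s A.\<close>

lemma popular_quotients_inv:
  assumes "A \<subseteq> carrier G" "s \<in> popular_quotients G A t"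
  shows "inv s \<in> popular_quotients G A t"
proof -
  have s: "s \<in> carrier G" using assms by (simp add: popular_quotients_def)
  have "bij_betw (\<lambda>w. s \<otimes> w) {w \<in> A. s \<otimes> w \<in> A} {w \<in> A. inv s \<otimes> w \<in> A}"
    by (rule bij_betw_byWitness[of _ "\<lambda>w. inv s \<otimes> w"])
      (use assms(1) s in \<open>auto simp: subset_iff m_assoc[symmetric]\<close>)
  then show ?thesis
    using assms s by (auto simp: popular_quotients_def dest: bij_betw_same_card)
qed

lemma one_popular_quotient:
  assumes "A \<subseteq> carrier G" "t \<le> real (card A)"
  shows "\<one> \<in> popular_quotients G A t"
proof -
  have "{w \<in> A. \<one> \<otimes> w \<in> A} = A" using assms by (auto simp: subset_iff)
  then show ?thesis using assms by (simp add: popular_quotients_def)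
qed

text \<open>The K translates A x_i all lie in \<open>B\<close>. An equality a x_i = w x_j means a =
  s w with s = x_j x_i^{-1}, so unpopular quotients make all pairwise overlaps smaller than t, and
  the union would be larger than \<open>B\<close>.\<close>

lemma popular_quotient_among_many:
  assumes A: "A \<subseteq> carrier G" and B: "finite B" and x: "\<And>i. i < K \<Longrightarrow> x i \<in> carrier G"
    and AB: "\<And>a i. a \<in> A \<Longrightarrow> i < K \<Longrightarrow> a \<otimes> x i \<in> B"
    and t: "0 \<le> t" "real (card B) < real K * real (card A) - (real K)\<^sup>2 * t"
  shows "\<exists>i j. i < j \<and> j < K \<and> x j \<otimes> inv x i \<in> popular_quotients G A t"
proof (rule ccontr)
  assume *: "\<not> ?thesis"
  define X where "X i = (\<lambda>a. a \<otimes> x i) ` A" for i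
  have XB: "X i \<subseteq> B" if "i < K" for i using AB that by (auto simp: X_def)
  then have finX: "finite (X i)" if "i < K" for i
    using B that finite_subset by blast
  have cardX: "card (X i) = card A" if "i < K" for i
    unfolding X_def by (rule card_image) (use A x[OF that] in \<open>auto simp: inj_on_def subset_iff\<close>)
  have small: "real (card (X i \<inter> X j)) \<le> t" if ij: "i < j" "j < K" for i j
  proof -
    define s where "s = x j \<otimes> inv x i"
    have xc: "x i \<in> carrier G" "x j \<in> carrier G" using x ij by auto
    then have s: "s \<in> carrier G" by (simp add: s_def)
    have "X i \<inter> X j \<subseteq> (\<lambda>w. w \<otimes> x j) ` {w \<in> A. s \<otimes> w \<in> A}"
    proof
      fix z assume "z \<in> X i \<inter> X j"
      then obtain a w where aw: "a \<in> A" "w \<in> A" "z = a \<otimes> x i" "z = w \<otimes> x j"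
        unfolding X_def by blast
      then have c: "a \<in> carrier G" "w \<in> carrier G" using A by auto
      have "s \<otimes> w = (w \<otimes> x j) \<otimes> inv x i"
        using c xc by (simp add: s_def m_ac)
      also have "\<dots> = a" using c xc aw by (metis inv_solve_right m_closed)
      finally have "s \<otimes> w \<in> A" using aw by simp
      then show "z \<in> (\<lambda>w. w \<otimes> x j) ` {w \<in> A. s \<otimes> w \<in> A}" using aw(2,4) by blast
    qed
    \<comment> \<open>This case is contradictory, as a translate of \<open>A\<close> lies in the
      finite set \<open>B\<close>. It is split off because comparing cardinalities under a
      surjection requires a finite domain.\<close>
    moreover have "{w \<in> A. s \<otimes> w \<in> A} = {}" if "infinite A"
      using cardX[OF ij(2)] XB[OF ij(2)] B that xc A
      by (metis X_def finite_imageD finite_subset inj_on_multc inj_on_subset)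
    ultimately have "card (X i \<inter> X j) \<le> card {w \<in> A. s \<otimes> w \<in> A}"
      by (cases "finite A") (auto intro: surj_card_le)
    moreover have "s \<notin> popular_quotients G A t"
      using * ij unfolding s_def by blast
    then have "real (card {w \<in> A. s \<otimes> w \<in> A}) < t"
      using s by (simp add: popular_quotients_def)
    ultimately show ?thesis by linarith
  qed
  have "real K * real (card A) - (real K)\<^sup>2 * t \<le> real (card (\<Union>i<K. X i))"
    by (rule card_UN_ge_if_small_overlaps)
      (use small t(1) cardX finX in simp_all)
  also have "\<dots> \<le> real (card B)"
    using XB B by (intro of_nat_mono card_mono) auto
  finally show False using t by simp
qed

text \<open>
  Fix a factorisation $x = s_1 \cdots s_k$ and put $E_j = A \cap s_j^{-1} A$. Every collision
  $w_1 \cdots w_k = w'_1 \cdots w'_k$ with $w, w' \in \prod_j E_j$ yields the representation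
  $x = \prod_j (s_j w_j) \cdot (\prod_j w'_j)^{-1}$, and Cauchy--Schwarz provides collisions.
\<close>

lemma card_representations_ge:
  assumes A: "A \<subseteq> carrier G" "finite A" and B: "finite B" and t: "0 \<le> t"
    and AB: "\<And>w. w \<in> {..<k} \<rightarrow> A \<Longrightarrow> (\<Otimes>j\<in>{..<k}. w j) \<in> B"
    and x: "x \<in> set_power G (popular_quotients G A t) k"
  shows "t ^ (2 * k) \<le> real (card B) * real (card (representations G k A x))"
proof -
  have "popular_quotients G A t \<subseteq> carrier G" by (auto simp: popular_quotients_def)
  then obtain s where s: "s \<in> {..<k} \<rightarrow> popular_quotients G A t" "x = (\<Otimes>j\<in>{..<k}. s j)"
    using x by (rule set_power_eq_finprod)
  have sc: "s \<in> {..<k} \<rightarrow> carrier G" using s(1) by (auto simp: popular_quotients_def)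
  define E where "E j = {w \<in> A. s j \<otimes> w \<in> A}" for j
  define W where "W = (\<Pi>\<^sub>E j\<in>{..<k}. E j)"
  define f where "f w = (\<Otimes>j\<in>{..<k}. w j)" for w
  define Q where "Q = {(w, w'). w \<in> W \<and> w' \<in> W \<and> f w = f w'}"
  \<comment> \<open>The first tuple is restricted to indices below k because representations are
    pairs of extensional tuples. Its entries s_j w_j lie in \<open>A\<close> by the choice of
    \<open>E j\<close>, and cancelling s_j makes \<open>g\<close> injective.\<close>
  define g where "g = (\<lambda>(w, w' :: nat \<Rightarrow> 'a). (\<lambda>j\<in>{..<k}. s j \<otimes> w j, w'))"
  have W: "w \<in> {..<k} \<rightarrow> A" "w \<in> {..<k} \<rightarrow> carrier G" if "w \<in> W" for w
    using that A by (auto simp: W_def E_def PiE_iff)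
  have "t ^ k = (\<Prod>j<k. t)" by simp
  also have "\<dots> \<le> (\<Prod>j<k. real (card (E j)))"
    by (rule prod_mono) (use t s(1) in \<open>auto simp: popular_quotients_def E_def\<close>)
  also have "\<dots> = real (card W)" by (simp add: W_def card_PiE)
  finally have "(t ^ k)\<^sup>2 \<le> (real (card W))\<^sup>2"
    using t by (intro power_mono) auto
  also have "\<dots> \<le> real (card B) * real (card Q)"
    unfolding Q_def
  proof (rule card_squared_le_card_collisions)
    show "finite W" unfolding W_def using A by (intro finite_PiE) (auto simp: E_def)
    show "f ` W \<subseteq> B" using AB W by (auto simp: f_def)
  qed (rule B)
  also have "\<dots> \<le> real (card B) * real (card (representations G k A x))"
  proof (intro mult_left_mono of_nat_mono)
    show "card Q \<le> card (representations G k A x)"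
    proof (rule card_inj_on_le)
      show "inj_on g Q"
      proof (rule inj_onI, clarify)
        fix w w' u u' assume Q: "(w, w') \<in> Q" "(u, u') \<in> Q" and eq: "g (w, w') = g (u, u')"
        have wu: "w \<in> W" "u \<in> W" using Q by (auto simp: Q_def)
        have "w j = u j" if "j < k" for j
        proof -
          have "s j \<otimes> w j = s j \<otimes> u j"
            using eq that by (auto simp: g_def fun_eq_iff split: if_splits)
          then show ?thesis using that sc W[OF wu(1)] W[OF wu(2)] by (auto simp: Pi_iff)
        qed
        then have "w = u" using wu unfolding W_def by (intro PiE_ext) auto
        then show "w = u \<and> w' = u'" using eq by (simp add: g_def)
      qed
      show "g ` Q \<subseteq> representations G k A x"
      proof (rule image_subsetI)
        fix q assume "q \<in> Q"
        then obtain w w' where q: "q = (w, w')" and w: "w \<in> W" "w' \<in> W" "f w = f w'" by (auto simp: Q_def)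
        have "(\<Otimes>j\<in>{..<k}. (\<lambda>j\<in>{..<k}. s j \<otimes> w j) j) = (\<Otimes>j\<in>{..<k}. s j \<otimes> w j)"
          by (rule finprod_cong') (use sc W[OF w(1)] in auto)
        also have "\<dots> = x \<otimes> f w"
          using sc W[OF w(1)] by (simp add: finprod_multf s(2) f_def)
        finally have "x = (\<Otimes>j\<in>{..<k}. (\<lambda>j\<in>{..<k}. s j \<otimes> w j) j) \<otimes> inv f w"
          using s(2) sc W[OF w(1)] by (simp add: m_assoc f_def)
        then have "x = (\<Otimes>j\<in>{..<k}. (\<lambda>j\<in>{..<k}. s j \<otimes> w j) j) \<otimes> inv (\<Otimes>j\<in>{..<k}. w' j)"
          unfolding w(3) unfolding f_def .
        moreover have "(\<lambda>j\<in>{..<k}. s j \<otimes> w j) \<in> {..<k} \<rightarrow>\<^sub>E A" "w' \<in> {..<k} \<rightarrow>\<^sub>E A"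
          using w by (auto simp: W_def E_def PiE_iff)
        ultimately show "g q \<in> representations G k A x"
          unfolding q g_def representations_def mem_Collect_eq prod.case by blast
      qed
      have "finite ({..<k} \<rightarrow>\<^sub>E A)" using A by (intro finite_PiE) auto
      then show "finite (representations G k A x)"
        by (rule_tac finite_subset[of _ "({..<k} \<rightarrow>\<^sub>E A) \<times> ({..<k} \<rightarrow>\<^sub>E A)"])
          (auto simp: representations_def)
    qed
  qed simp
  finally show ?thesis
    by (simp only: power_even_eq)
qed

section \<open>Arithmetic and size of coset progressions\<close>

lemma lin_comb_closed: "v ` {..<r} \<subseteq> carrier G \<Longrightarrow> lin_comb G r v n \<in> carrier G"
  unfolding lin_comb_def by (rule finprod_closed) auto

lemma lin_comb_cong:
  "v ` {..<r} \<subseteq> carrier G \<Longrightarrow> (\<And>i. i < r \<Longrightarrow> n i = n' i) \<Longrightarrow> lin_comb G r v n = lin_comb G r v n'"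
  unfolding lin_comb_def by (rule finprod_cong') auto

lemma lin_comb_add:
  assumes "v ` {..<r} \<subseteq> carrier G"
  shows "lin_comb G r v (\<lambda>i. n i + n' i) = lin_comb G r v n \<otimes> lin_comb G r v n'"
proof -
  have "lin_comb G r v (\<lambda>i. n i + n' i) = (\<Otimes>i\<in>{..<r}. v i [^] n i \<otimes> v i [^] n' i)"
    unfolding lin_comb_def by (rule finprod_cong') (use assms in \<open>auto simp: int_pow_mult\<close>)
  also have "\<dots> = lin_comb G r v n \<otimes> lin_comb G r v n'"
    unfolding lin_comb_def by (rule finprod_multf) (use assms in auto)
  finally show ?thesis .
qed

lemma lin_comb_single:
  assumes "v ` {..<r} \<subseteq> carrier G" "i < r"
  shows "lin_comb G r v (\<lambda>j. if j = i then a else 0) = v i [^] a"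
proof -
  have "lin_comb G r v (\<lambda>j. if j = i then a else 0)
      = (\<Otimes>j\<in>{..<r}. if i = j then (\<lambda>j. v j [^] a) j else \<one>)"
    unfolding lin_comb_def by (rule finprod_cong') (use assms in auto)
  also have "\<dots> = v i [^] a"
    by (rule finprod_singleton) (use assms in auto)
  finally show ?thesis .
qed

lemma progression_closed: "v ` {..<r} \<subseteq> carrier G \<Longrightarrow> progression G r v N \<subseteq> carrier G"
  by (auto simp: progression_def lin_comb_closed)

lemma lin_comb_in_progression:
  assumes "v ` {..<r} \<subseteq> carrier G" "\<And>i. i < r \<Longrightarrow> real_of_int \<bar>n i\<bar> \<le> N i"
  shows "lin_comb G r v n \<in> progression G r v N"
proof -
  have "lin_comb G r v n = lin_comb G r v (restrict n {..<r})"
    by (rule lin_comb_cong) (use assms in auto)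
  moreover have "restrict n {..<r} \<in> coeff_box r N"
    using assms(2) by (auto simp: coeff_box_def)
  ultimately show ?thesis by (auto simp: progression_def)
qed

lemma progression_mult:
  assumes v: "v ` {..<r} \<subseteq> carrier G" and "x \<in> progression G r v M" "y \<in> progression G r v N"
  shows "x \<otimes> y \<in> progression G r v (\<lambda>i. M i + N i)"
proof -
  obtain n n' where n: "n \<in> coeff_box r M" "n' \<in> coeff_box r N"
    and xy: "x = lin_comb G r v n" "y = lin_comb G r v n'"
    using assms(2,3) by (auto simp: progression_def)
  have "lin_comb G r v (\<lambda>i. n i + n' i) \<in> progression G r v (\<lambda>i. M i + N i)"
  proof (rule lin_comb_in_progression[OF v])
    fix i assume "i < r"
    then have "real_of_int \<bar>n i\<bar> \<le> M i" "real_of_int \<bar>n' i\<bar> \<le> N i"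
      using n by (auto simp: coeff_box_def)
    then show "real_of_int \<bar>n i + n' i\<bar> \<le> M i + N i" by simp
  qed
  then show ?thesis by (simp add: xy lin_comb_add[OF v])
qed

lemma coset_progression_mult:
  assumes H: "subgroup H G" and v: "v ` {..<r} \<subseteq> carrier G"
    and "x \<in> H <#> progression G r v M" "y \<in> H <#> progression G r v N"
  shows "x \<otimes> y \<in> H <#> progression G r v (\<lambda>i. M i + N i)"
proof -
  obtain h p h' p' where *: "h \<in> H" "p \<in> progression G r v M" "x = h \<otimes> p"
      "h' \<in> H" "p' \<in> progression G r v N" "y = h' \<otimes> p'"
    using assms(3,4) by (auto simp: set_mult_def)
  then have "h \<in> carrier G" "h' \<in> carrier G" "p \<in> carrier G" "p' \<in> carrier G"
    using subgroup.subset[OF H] progression_closed[OF v] by blast+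
  then have "x \<otimes> y = (h \<otimes> h') \<otimes> (p \<otimes> p')" by (simp add: * m_ac)
  moreover have "h \<otimes> h' \<in> H" "p \<otimes> p' \<in> progression G r v (\<lambda>i. M i + N i)"
    using * progression_mult[OF v] subgroup.m_closed[OF H] by auto
  ultimately show ?thesis unfolding set_mult_def by blast
qed

lemma coset_progression_closed:
  "subgroup H G \<Longrightarrow> v ` {..<r} \<subseteq> carrier G \<Longrightarrow> H <#> progression G r v N \<subseteq> carrier G"
  by (simp add: set_mult_closed subgroup.subset progression_closed)

lemma subgroup_subset_coset_progression:
  assumes "subgroup H G" "v ` {..<r} \<subseteq> carrier G" "\<And>i. i < r \<Longrightarrow> 0 \<le> N i"
  shows "H \<subseteq> H <#> progression G r v N"
proof
  fix h assume h: "h \<in> H"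
  have "lin_comb G r v (\<lambda>i. 0) \<in> progression G r v N"
    by (rule lin_comb_in_progression) (use assms in auto)
  moreover have "lin_comb G r v (\<lambda>i. 0) = \<one>" by (simp add: lin_comb_def)
  ultimately show "h \<in> H <#> progression G r v N"
    using h subgroup.mem_carrier[OF assms(1) h] by (force simp: set_mult_def)
qed

lemma generator_power_in_coset_progression:
  assumes "subgroup H G" "v ` {..<r} \<subseteq> carrier G" "\<And>i. i < r \<Longrightarrow> 0 \<le> N i"
    and "i < r" "real_of_int \<bar>a\<bar> \<le> N i"
  shows "v i [^] a \<in> H <#> progression G r v N"
proof -
  have "v i [^] a \<in> progression G r v N"
    unfolding lin_comb_single[OF assms(2,4), symmetric]
    by (rule lin_comb_in_progression) (use assms in auto)
  moreover have "v i [^] a \<in> carrier G" using assms by auto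
  ultimately show ?thesis
    using subgroup.one_closed[OF assms(1)] by (force simp: set_mult_def)
qed

text \<open>This supplies the set \<open>B\<close> in which the k-fold products of elements of
  \<open>A\<close> collide: its size exceeds that of H P only by a factor depending on k and
  r.\<close>

lemma finprod_in_coset_progression:
  assumes H: "subgroup H G" and v: "v ` {..<r} \<subseteq> carrier G"
    and "w \<in> {..<k} \<rightarrow> H <#> progression G r v N"
  shows "(\<Otimes>j\<in>{..<k}. w j) \<in> H <#> progression G r v (\<lambda>i. real k * N i)"
  using assms(3)
proof (induction k)
  \<comment> \<open>The empty product lies in \<open>H\<close>, which is contained in the coset
    progression with all bounds 0.\<close>
  case 0
  show ?case
    using subgroup_subset_coset_progression[OF H v, of "\<lambda>i. 0"] subgroup.one_closed[OF H] by auto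
next
  case (Suc k)
  have "w \<in> {..<Suc k} \<rightarrow> carrier G"
    using Suc.prems coset_progression_closed[OF H v] by blast
  then have "(\<Otimes>j\<in>{..<Suc k}. w j) = w k \<otimes> (\<Otimes>j\<in>{..<k}. w j)"
    by (simp add: lessThan_Suc Pi_iff)
  moreover have "w k \<otimes> (\<Otimes>j\<in>{..<k}. w j)
      \<in> H <#> progression G r v (\<lambda>i. N i + real k * N i)"
    by (rule coset_progression_mult[OF H v]) (use Suc in \<open>auto simp: Pi_iff less_Suc_eq\<close>)
  ultimately show ?case by (simp add: algebra_simps)
qed

text \<open>Fixing the \<open>H\<close>-component to be the identity turns properness into
  injectivity of \<open>lin_comb\<close> on the box.\<close>

lemma card_progression_proper:
  assumes "proper_coset_progression G H r v N"
  shows "card (progression G r v N) = card (coeff_box r N)"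
proof -
  have H: "subgroup H G" and v: "v ` {..<r} \<subseteq> carrier G"
    and inj: "inj_on (\<lambda>(h, n). h \<otimes> lin_comb G r v n) (H \<times> coeff_box r N)"
    using assms by (auto simp: proper_coset_progression_def)
  have "inj_on (lin_comb G r v) (coeff_box r N)"
  proof (rule inj_onI)
    fix n n' assume "n \<in> coeff_box r N" "n' \<in> coeff_box r N" "lin_comb G r v n = lin_comb G r v n'"
    then show "n = n'"
      using inj_onD[OF inj, of "(\<one>, n)" "(\<one>, n')"] subgroup.one_closed[OF H] by simp
  qed
  then show ?thesis by (simp add: progression_def card_image)
qed

text \<open>The dilate may fail to be proper, so its size is only bounded above, by counting
  coefficient vectors. Properness of the original progression then expresses the size of the
  undilated box through |P|.\<close>

lemma coset_progression_dilate_bounds: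
  assumes proper: "proper_coset_progression G H r v N" and k: "1 \<le> k"
  shows "finite (H <#> progression G r v (\<lambda>i. real k * N i))"
    and "card (H <#> progression G r v (\<lambda>i. real k * N i))
      \<le> (2 * k) ^ r * (card H * card (progression G r v N))"
proof -
  let ?P = "progression G r v (\<lambda>i. real k * N i)"
  have H: "finite H" and N: "\<And>i. i < r \<Longrightarrow> 1 \<le> N i"
    using proper by (auto simp: proper_coset_progression_def)
  have box: "finite (coeff_box r (\<lambda>i. real k * N i))"
    by (rule finite_coeff_box) (use N in \<open>force intro: mult_nonneg_nonneg\<close>)
  then have P: "finite ?P" by (simp add: progression_def)
  have eq: "H <#> ?P = (\<lambda>(h, p). h \<otimes> p) ` (H \<times> ?P)" by (auto simp: set_mult_def)
  then show "finite (H <#> ?P)" using H P by simp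
  have "card (H <#> ?P) \<le> card H * card ?P"
    unfolding eq using H P by (metis card_cartesian_product card_image_le finite_cartesian_product)
  also have "card ?P \<le> card (coeff_box r (\<lambda>i. real k * N i))"
    unfolding progression_def by (rule card_image_le[OF box])
  also have "\<dots> \<le> (2 * k) ^ r * card (progression G r v N)"
    using card_coeff_box_dilate_le[OF N k] card_progression_proper[OF proper] by simp
  finally show "card (H <#> ?P) \<le> (2 * k) ^ r * (card H * card (progression G r v N))"
    by (simp add: mult_ac)
qed

section \<open>The coset progression inside a bounded power of the popular quotients\<close>

text \<open>With n = |H||P|, the threshold 4^r n / K^2 makes the total overlap loss equal to 4^r n,
  which is also the bound for the size of the twofold dilate. The hypothesis on K says that the
  translates have total size K|A| > 2 4^r n, so two of any K translates of \<open>A\<close> by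
  elements of H P must overlap substantially. This is applied once to elements of \<open>H\<close>
  and once to powers of each generator.\<close>

lemma popular_quotients_contain_coset_progression:
  fixes \<delta> :: real
  assumes proper: "proper_coset_progression G H r v N"
    and A: "A \<subseteq> H <#> progression G r v N"
      "\<delta> * (real (card H) * real (card (progression G r v N))) \<le> real (card A)"
    and K: "2 * 4 ^ r < real K * \<delta>"
    and S: "S = popular_quotients G A (4 ^ r / (real K)\<^sup>2 * (real (card H) * real (card (progression G r v N))))"
  obtains H' where "subgroup H' G" "H' \<subseteq> H" "card H \<le> K * card H'"
    and "H' <#> shrunk_progression G r v N (fact K) \<subseteq> set_power G S (2 * K * (r + 1))"
proof -
  let ?B = "H <#> progression G r v N"
  define n where "n = real (card H) * real (card (progression G r v N))"
  have H: "subgroup H G" "finite H" and v: "v ` {..<r} \<subseteq> carrier G" and N: "\<And>i. i < r \<Longrightarrow> 1 \<le> N i"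
    using proper by (auto simp: proper_coset_progression_def)
  have N0: "0 \<le> N i" if "i < r" for i using N[OF that] by simp
  have Bc: "?B \<subseteq> carrier G" by (rule coset_progression_closed[OF H(1) v])
  then have Ac: "A \<subseteq> carrier G" using A by blast
  have Sc: "S \<subseteq> carrier G" by (auto simp: S popular_quotients_def)
  have B1: "finite ?B" using coset_progression_dilate_bounds(1)[OF proper, of 1] by simp
  have P: "finite (progression G r v N)" "progression G r v N \<noteq> {}"
    using finite_coeff_box[of r N, OF N0] lin_comb_in_progression[OF v, of "\<lambda>_. 0" N] N0
    by (auto simp: progression_def)
  have n: "0 < n"
    using P H subgroup.one_closed[OF H(1)] unfolding n_def
    by (metis card_gt_0_iff empty_iff mult_pos_pos of_nat_0_less_iff)
  have K0: "1 \<le> real K"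
  proof (cases K)
    case 0
    then show ?thesis using K by (simp add: not_less)
  qed simp
  have \<delta>0: "0 < \<delta>"
  proof (rule ccontr)
    assume "\<not> 0 < \<delta>"
    then have "real K * \<delta> \<le> 0" using K0 by (simp add: mult_nonneg_nonpos)
    moreover have "(0 :: real) < 2 * 4 ^ r" by simp
    ultimately show False using K by linarith
  qed
  define t where "t = 4 ^ r / (real K)\<^sup>2 * n"
  have St: "S = popular_quotients G A t" by (simp add: S t_def n_def)
  \<comment> \<open>This places the threshold \<open>t\<close> below |A|, so that the identity is a
    popular quotient.\<close>
  have "4 ^ r / (real K)\<^sup>2 \<le> \<delta>"
  proof -
    have "(0 :: real) < 4 ^ r" by simp
    then have "4 ^ r \<le> real K * \<delta>" using K by linarith
    also have "\<dots> \<le> (real K)\<^sup>2 * \<delta>"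
      using K0 \<delta>0 by (simp add: power2_eq_square)
    finally show ?thesis using K0 by (simp add: divide_le_eq mult.commute)
  qed
  then have "t \<le> \<delta> * n" unfolding t_def using n by (intro mult_right_mono) auto
  then have oneS: "\<one> \<in> S"
    unfolding St using one_popular_quotient[OF Ac] A(2) n_def by simp
  have invS: "inv s \<in> S" if "s \<in> S" for s
    using popular_quotients_inv[OF Ac] that by (simp add: St)
  have adj: "\<exists>i j. i < j \<and> j < K \<and> x j \<otimes> inv x i \<in> S"
    if x: "\<And>i. i < K \<Longrightarrow> x i \<in> ?B" for x
    unfolding St
  proof (rule popular_quotient_among_many[OF Ac])
    let ?B2 = "H <#> progression G r v (\<lambda>i. real 2 * N i)"
    show "finite ?B2" by (rule coset_progression_dilate_bounds[OF proper]) simp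
    show "x i \<in> carrier G" if "i < K" for i using x[OF that] Bc by blast
    show "a \<otimes> x i \<in> ?B2" if "a \<in> A" "i < K" for a i
      using coset_progression_mult[OF H(1) v, of a N "x i" N] that A x by auto
    show "0 \<le> t" using n by (simp add: t_def)
    have "card ?B2 \<le> (2 * 2) ^ r * (card H * card (progression G r v N))"
      by (rule coset_progression_dilate_bounds[OF proper]) simp
    then have "real (card ?B2) \<le> real ((2 * 2) ^ r * (card H * card (progression G r v N)))"
      by (rule of_nat_mono)
    then have "real (card ?B2) \<le> 4 ^ r * n" by (simp add: n_def)
    moreover have "(real K)\<^sup>2 * t = 4 ^ r * n" using K0 by (simp add: t_def)
    moreover have "2 * 4 ^ r * n < real K * \<delta> * n"
      using K n by simp
    moreover have "real K * (\<delta> * n) \<le> real K * real (card A)"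
      using A(2) by (intro mult_left_mono) (simp_all add: n_def)
    ultimately show "real (card ?B2) < real K * real (card A) - (real K)\<^sup>2 * t"
      by (simp add: mult.assoc)
  qed
  have HB: "H \<subseteq> ?B" by (rule subgroup_subset_coset_progression[OF H(1) v N0])
  \<comment> \<open>Any K elements of \<open>H\<close> have a quotient in S \<inter> H, so the
    subgroup generated by this set has index at most K in \<open>H\<close>.\<close>
  define H' where "H' = generate G (S \<inter> H)"
  have adjH: "\<exists>i j. i < j \<and> j < K \<and> x j \<otimes> inv x i \<in> S" if "\<And>i. i < K \<Longrightarrow> x i \<in> H" for x
    by (rule adj) (use that HB in blast)
  have H'_sub: "subgroup H' G"
    unfolding H'_def by (rule generate_is_subgroup) (use Sc in blast)
  have H'_H: "H' \<subseteq> H"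
    unfolding H'_def by (rule generate_subgroup_incl) (use H in auto)
  have H'_pow: "H' \<subseteq> set_power G S (2 * K)"
    unfolding H'_def by (rule generate_Int_subset_set_power[OF Sc oneS invS H(1) adjH])
  have H'_card: "card H \<le> K * card H'"
  proof (rule card_le_if_no_large_transversal[OF H H'_sub H'_H])
    fix x :: "nat \<Rightarrow> 'a" assume x: "\<And>i. i < K \<Longrightarrow> x i \<in> H"
    then obtain i j where ij: "i < j" "j < K" "x j \<otimes> inv x i \<in> S" using adjH by blast
    then have "x j \<otimes> inv x i \<in> H"
      using x H by (simp add: subgroup.m_closed subgroup.m_inv_closed)
    then have "x j \<otimes> inv x i \<in> H'"
      using ij unfolding H'_def by (simp add: generate.incl)
    then show "\<exists>i j. i < j \<and> j < K \<and> x j \<otimes> inv x i \<in> H'" using ij(1,2) by blast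
  qed
  have gen: "v i [^] (int (fact K) * a) \<in> set_power G S (2 * K)"
    if i: "i < r" and a: "real_of_int \<bar>a\<bar> \<le> N i / (real (fact K))\<^sup>2" for i a
  \<comment> \<open>If N_i < K, then N_i < (K!)^2 and the only admissible coefficient is 0.
    Otherwise the first K powers of v_i lie in H P and pigeonhole applies to them.\<close>
  proof (cases "real K \<le> N i")
    case False
    have "K * 1 \<le> fact K * (fact K :: nat)"
      by (intro mult_mono fact_ge_self fact_ge_1) auto
    then have "real (K * 1) \<le> real (fact K * fact K)" by (rule of_nat_mono)
    then have "N i < (real (fact K))\<^sup>2" using False by (simp add: power2_eq_square)
    then have "N i / (real (fact K))\<^sup>2 < 1" by simp
    then have "a = 0" using a by linarith
    moreover have "\<one> \<in> set_power G S (2 * K)"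
      using set_power_mono[OF Sc oneS, of 0 "2 * K"] by simp
    ultimately show ?thesis by simp
  next
    case True
    have vi: "v i \<in> carrier G" using v i by auto
    define x where "x j = v i [^] int j" for j
    have "x j \<in> ?B" if "j < K" for j
      unfolding x_def
      by (rule generator_power_in_coset_progression[OF H(1) v N0 i]) (use that True in simp_all)
    then obtain j k where jk: "j < k" "k < K" "x k \<otimes> inv x j \<in> S"
      using adj by blast
    define d where "d = k - j"
    have d: "0 < d" "d \<le> K" using jk by (auto simp: d_def)
    have "x k \<otimes> inv x j = v i [^] int d"
      using vi jk by (simp add: x_def d_def of_nat_diff int_pow_diff)
    then have dS: "v i [^] int d \<in> S" using jk by simp
    \<comment> \<open>The difference d depends on the generator, but it never exceeds K, so the
      single value l = K! is a multiple of all of them.\<close>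
    have "d dvd fact K" using d by (simp add: dvd_fact)
    then obtain e where e: "fact K = d * e" by (auto simp: dvd_def)
    have eq: "int (fact K) * a = int d * (int e * a)"
      unfolding e by simp
    \<comment> \<open>With |a| \<le> N_i / l^2 the exponent l a has size at most N_i / l, so the
      whole walk in steps of d remains within the original range N_i.\<close>
    have "real (fact K) * real_of_int \<bar>a\<bar> \<le> real (fact K) * (N i / (real (fact K))\<^sup>2)"
      using a by (intro mult_left_mono) auto
    also have "\<dots> = N i / real (fact K)" by (simp add: power2_eq_square)
    also have "\<dots> \<le> N i"
      using N0[OF i] fact_ge_1[of K] by (simp add: divide_le_eq mult_le_cancel_left1)
    finally have "real_of_int \<bar>int (fact K) * a\<bar> \<le> N i"
      by (simp add: abs_mult)
    then have le: "\<bar>int d * (int e * a)\<bar> \<le> \<lfloor>N i\<rfloor>" unfolding eq by (simp only: le_floor_iff)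
    show ?thesis
      unfolding eq
    proof (rule int_pow_multiple_in_set_power[OF Sc oneS invS vi _ _ dS le])
      fix y :: "nat \<Rightarrow> 'a"
      assume y: "\<And>j. j < K \<Longrightarrow> \<exists>b. \<bar>b\<bar> \<le> \<lfloor>N i\<rfloor> \<and> y j = v i [^] b"
      have "y j \<in> ?B" if "j < K" for j
        using y[OF that] generator_power_in_coset_progression[OF H(1) v N0 i]
        by (auto simp: le_floor_iff)
      then show "\<exists>j k. j < k \<and> k < K \<and> y k \<otimes> inv y j \<in> S" using adj by blast
    next
      show "0 < int d" using d by simp
    qed
  qed
  \<comment> \<open>There are 2K factors for the component in \<open>H'\<close> and 2K for each of
    the r generators.\<close>
  have "H' <#> shrunk_progression G r v N (fact K) \<subseteq> set_power G S (2 * K + 2 * K * r)"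
  proof
    fix z assume "z \<in> H' <#> shrunk_progression G r v N (fact K)"
    then obtain h a where ha: "h \<in> H'" "a \<in> coeff_box r (\<lambda>i. N i / (real (fact K))\<^sup>2)"
      "z = h \<otimes> lin_comb G r v (\<lambda>i. int (fact K) * a i)"
      by (auto simp: set_mult_def shrunk_progression_def)
    have "lin_comb G r v (\<lambda>i. int (fact K) * a i) \<in> set_power G S (2 * K * r)"
      unfolding lin_comb_def
      by (rule set_power_finprod[OF Sc], rule gen) (use ha(2) in \<open>auto simp: coeff_box_def\<close>)
    then show "z \<in> set_power G S (2 * K + 2 * K * r)"
      using set_power_mult[OF Sc] ha H'_pow by blast
  qed
  then show thesis
    using that[OF H'_sub H'_H H'_card] by (simp add: algebra_simps)
qed

text \<open>The collision count gives (\<epsilon> n)^{2m} \<le> |B| R, where n = |H||P|, R is the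
  number of representations and |B| \<le> (2m)^r n. Dividing by |B| costs one factor n, whence the
  exponent 2m - 1.\<close>

lemma many_representations_if_set_power:
  fixes \<epsilon> :: real
  assumes proper: "proper_coset_progression G H r v N"
    and A: "A \<subseteq> H <#> progression G r v N" and \<epsilon>: "0 \<le> \<epsilon>" and m: "1 \<le> m"
    and x: "x \<in> set_power G (popular_quotients G A (\<epsilon> * (real (card H) * real (card (progression G r v N))))) m"
  shows "\<epsilon> ^ (2 * m) / (2 * real m) ^ r * real (card H) ^ (2 * m - 1) *
    real (card (progression G r v N)) ^ (2 * m - 1) \<le> real (card (representations G m A x))"
proof -
  define n where "n = real (card H) * real (card (progression G r v N))"
  let ?B = "H <#> progression G r v (\<lambda>i. real m * N i)"
  let ?R = "real (card (representations G m A x))"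
  have H: "subgroup H G" and v: "v ` {..<r} \<subseteq> carrier G"
    using proper by (auto simp: proper_coset_progression_def)
  have fin: "finite A"
    using coset_progression_dilate_bounds(1)[OF proper, of 1] A by (auto intro: finite_subset)
  have "(\<epsilon> * n) ^ (2 * m) \<le> real (card ?B) * ?R"
  proof (rule card_representations_ge)
    show "A \<subseteq> carrier G" using A coset_progression_closed[OF H v] by blast
    show "(\<Otimes>j\<in>{..<m}. w j) \<in> ?B" if "w \<in> {..<m} \<rightarrow> A" for w
      by (rule finprod_in_coset_progression[OF H v]) (use that A in blast)
  qed (use fin \<epsilon> x coset_progression_dilate_bounds(1)[OF proper m] in \<open>simp_all add: n_def\<close>)
  also have "real (card ?B) \<le> (2 * real m) ^ r * n"
    using of_nat_mono[OF coset_progression_dilate_bounds(2)[OF proper m], where 'a = real]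
    by (simp add: n_def)
  finally have le: "(\<epsilon> * n) ^ (2 * m) \<le> (2 * real m) ^ r * n * ?R"
    by (simp add: mult_right_mono)
  have "\<epsilon> ^ (2 * m) / (2 * real m) ^ r * n ^ (2 * m - 1) \<le> ?R"
  \<comment> \<open>For n = 0 the left side vanishes because the exponent 2m - 1 is positive;
    otherwise one factor n can be cancelled.\<close>
  proof (cases "n = 0")
    case True
    then show ?thesis using m by (simp add: zero_power)
  next
    case False
    then have n: "0 < n" by (simp add: n_def)
    have "n ^ (2 * m) = n * n ^ (2 * m - 1)"
      using m by (metis One_nat_def Suc_pred mult_2 power_Suc trans_less_add1 less_eq_Suc_le)
    then have "n * (\<epsilon> ^ (2 * m) * n ^ (2 * m - 1)) \<le> n * ((2 * real m) ^ r * ?R)"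
      using le by (simp add: power_mult_distrib mult_ac)
    then have "\<epsilon> ^ (2 * m) * n ^ (2 * m - 1) \<le> (2 * real m) ^ r * ?R"
      using n by simp
    then show ?thesis
      using m by (simp add: divide_le_eq mult_ac)
  qed
  then show ?thesis by (simp add: n_def power_mult_distrib mult_ac)
qed

end

section \<open>Choice of the constants and conclusion\<close>

text \<open>All constants are built from \<delta> and r: the index bound is K, l is K!, m is 2K(r +
  1), and the sum m + K! bounds both m and l. The exponent in the representation count is 2m - 1:
  any 2m - 1 entries of a representation determine the last, so no element has more than |A|^{2m-1}
  of them.\<close>

theorem propositionB5:
  fixes \<delta> :: real and r :: nat
  assumes "0 < \<delta>" and "\<delta> < 1"
  shows "\<exists>c\<^sub>1 C c\<^sub>2 :: real. 0 < c\<^sub>1 \<and> 0 < C \<and> 0 < c\<^sub>2 \<and>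
    (\<forall>(G :: 'a monoid) H v N A.
       comm_group G \<longrightarrow>
       proper_coset_progression G H r v N \<longrightarrow>
       A \<subseteq> H <#>\<^bsub>G\<^esub> progression G r v N \<longrightarrow>
       real (card A) \<ge> \<delta> * real (card H) * real (card (progression G r v N)) \<longrightarrow>
       (\<exists>H' m l. subgroup H' G \<and> H' \<subseteq> H \<and> real (card H') \<ge> c\<^sub>1 * real (card H) \<and>
          1 \<le> m \<and> real m \<le> C \<and> 1 \<le> l \<and> real l \<le> C \<and>
          H' <#>\<^bsub>G\<^esub> shrunk_progression G r v N l \<subseteq> iter_diff G m A \<and>
          (\<forall>x \<in> H' <#>\<^bsub>G\<^esub> shrunk_progression G r v N l.
             real (card (representations G m A x)) \<ge>
               c\<^sub>2 * real (card H) ^ (2 * m - 1) *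
                 real (card (progression G r v N)) ^ (2 * m - 1))))"
proof -
  \<comment> \<open>The successor makes the inequality 2 4^r < K \<delta> strict and ensures K \<ge>
    1.\<close>
  define K where "K = Suc (nat \<lceil>2 * 4 ^ r / \<delta>\<rceil>)"
  define m where "m = 2 * K * (r + 1)"
  define \<epsilon> :: real where "\<epsilon> = 4 ^ r / (real K)\<^sup>2"
  define c\<^sub>2 where "c\<^sub>2 = \<epsilon> ^ (2 * m) / (2 * real m) ^ r"
  have "2 * 4 ^ r / \<delta> < real K"
    unfolding K_def by linarith
  then have K: "2 * 4 ^ r < real K * \<delta>"
    using assms by (simp add: divide_less_eq)
  have m: "1 \<le> m" by (simp add: m_def K_def)
  have \<epsilon>: "0 < \<epsilon>" by (simp add: \<epsilon>_def K_def)
  have c\<^sub>2: "0 < c\<^sub>2" using \<epsilon> m by (simp add: c\<^sub>2_def)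
  have main: "\<exists>H' m l. subgroup H' G \<and> H' \<subseteq> H \<and> real (card H') \<ge> 1 / real K * real (card H) \<and>
      1 \<le> m \<and> real m \<le> C \<and> 1 \<le> l \<and> real l \<le> C \<and>
      H' <#>\<^bsub>G\<^esub> shrunk_progression G r v N l \<subseteq> iter_diff G m A \<and>
      (\<forall>x \<in> H' <#>\<^bsub>G\<^esub> shrunk_progression G r v N l.
         real (card (representations G m A x)) \<ge>
           c\<^sub>2 * real (card H) ^ (2 * m - 1) * real (card (progression G r v N)) ^ (2 * m - 1))"
    if C: "C = real m + fact K" and G: "comm_group G" and proper: "proper_coset_progression G H r v N"
      and A: "A \<subseteq> H <#>\<^bsub>G\<^esub> progression G r v N"
        "real (card A) \<ge> \<delta> * real (card H) * real (card (progression G r v N))"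
    for C and G :: "'a monoid" and H v N A
  proof -
    interpret comm_group G by (rule G)
    define S where "S = popular_quotients G A (\<epsilon> * (real (card H) * real (card (progression G r v N))))"
    have A2: "\<delta> * (real (card H) * real (card (progression G r v N))) \<le> real (card A)"
      using A(2) by (simp add: mult.assoc)
    obtain H' where H': "subgroup H' G" "H' \<subseteq> H" "card H \<le> K * card H'"
      and sub: "H' <#>\<^bsub>G\<^esub> shrunk_progression G r v N (fact K) \<subseteq> set_power G S m"
      using popular_quotients_contain_coset_progression[OF proper A(1) A2 K S_def[unfolded \<epsilon>_def]]
      unfolding m_def by blast
    have reps: "c\<^sub>2 * real (card H) ^ (2 * m - 1) * real (card (progression G r v N)) ^ (2 * m - 1)
        \<le> real (card (representations G m A x))"
      if "x \<in> H' <#>\<^bsub>G\<^esub> shrunk_progression G r v N (fact K)" for x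
      unfolding c\<^sub>2_def
      by (rule many_representations_if_set_power[OF proper A(1) _ m])
        (use \<epsilon> sub that in \<open>auto simp: S_def\<close>)
    \<comment> \<open>Both cardinalities must be positive for the lower bound on the number of
      representations to be positive; membership in \<open>iter_diff\<close> then follows from the
      existence of a representation.\<close>
    have "0 < card H"
      using proper subgroup.one_closed by (fastforce simp: proper_coset_progression_def card_gt_0_iff)
    moreover have "0 < card (progression G r v N)"
    proof -
      have N: "0 \<le> N i" if "i < r" for i
        using proper that by (force simp: proper_coset_progression_def)
      then have "restrict (\<lambda>_. 0) {..<r} \<in> coeff_box r N" by (simp add: coeff_box_def)
      moreover have "finite (coeff_box r N)" by (rule finite_coeff_box[OF N])
      ultimately show ?thesis unfolding card_progression_proper[OF proper] by (auto simp: card_gt_0_iff)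
    qed
    ultimately have pos:
      "0 < c\<^sub>2 * real (card H) ^ (2 * m - 1) * real (card (progression G r v N)) ^ (2 * m - 1)"
      using c\<^sub>2 by simp
    have "H' <#>\<^bsub>G\<^esub> shrunk_progression G r v N (fact K) \<subseteq> iter_diff G m A"
    proof
      fix x assume "x \<in> H' <#>\<^bsub>G\<^esub> shrunk_progression G r v N (fact K)"
      then have "representations G m A x \<noteq> {}"
        using reps[of x] pos by auto
      then show "x \<in> iter_diff G m A"
        by (auto simp: representations_def iter_diff_def)
    qed
    moreover have "1 / real K * real (card H) \<le> real (card H')"
    proof -
      have "real (card H) \<le> real K * real (card H')"
        using H'(3) by (metis of_nat_le_iff of_nat_mult)
      then show ?thesis by (simp add: K_def divide_le_eq mult.commute)
    qed
    ultimately show ?thesis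
      using H' reps m
      by (intro exI[of _ H'] exI[of _ m] exI[of _ "fact K"]) (auto simp: C)
  qed
  show ?thesis
    by (rule exI[of _ "1 / real K"], rule exI[of _ "real m + fact K"], rule exI[of _ c\<^sub>2],
        intro conjI allI impI, simp add: K_def, simp add: add_nonneg_pos, rule c\<^sub>2,
        rule main[OF refl])
qed

end
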